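(* For every integer $n\ge 3$, the weak set-labeling number of the cycle $C_n$ on $n$ vertices is $\sigma^{\ast}(C_n)=2+\lfloor \frac{n}{2}\rfloor$.
   Context: All graphs are simple, finite and have no isolated vertices. $\mathbb{N}_0$ is the set of non-negative integers, $\mathcal{P}(X)$ is the power set of $X$, and for finite sets $A,B\subset\mathbb{N}_0$ the sumset is $A+B=\{a+b: a\in A, b\in B\}$. Let $X\subset\mathbb{N}_0$ be a non-empty finite set (the ground set). An integer additive set-labeling (IASL) of a graph $G$ with respect to $X$ is an injective function $f:V(G)\to\mathcal{P}(X)$ such that the induced edge function $f^+(uv)=f(u)+f(v)$, $uv\in E(G)$, takes values in $\mathcal{P}(X)$ (i.e. $f(u)+f(v)\subseteq X$ for every edge $uv$). An IASL $f$ is a weak integer additive set-labeling (WIASL) if $|f^+(uv)|=\max(|f(u)|,|f(v)|)$ for every edge $uv\in E(G)$. A labeling is $1$-uniform if $|f^+(uv)|=1$ for every edge $uv$; throughout, only labelings that are not $1$-uniform are considered. The weak set-labeling number $\sigma^{\ast}(G)$ is the minimum cardinality of a ground set $X$ such that $G$ admits a (not $1$-uniform) WIASL with respect to $X$. *)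

theory Defs
  imports Main "HOL-Library.Set_Algebras"
begin

text \<open>
  A graph is a pair of a vertex set and a set of edges, an edge being the two-element set
  of its end points.
\<close>

type_synonym 'a ugraph = "'a set \<times> 'a set set"

abbreviation verts :: "'a ugraph \<Rightarrow> 'a set" where "verts G \<equiv> fst G"
abbreviation edges :: "'a ugraph \<Rightarrow> 'a set set" where "edges G \<equiv> snd G"

definition simple_graph :: "'a ugraph \<Rightarrow> bool" where
  "simple_graph G \<longleftrightarrow>
     finite (verts G) \<and> (\<forall>e\<in>edges G. e \<subseteq> verts G \<and> card e = 2)"

definition no_isolated_vertices :: "'a ugraph \<Rightarrow> bool" where
  "no_isolated_vertices G \<longleftrightarrow> (\<forall>v\<in>verts G. \<exists>e\<in>edges G. v \<in> e)"

text \<open>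
  The sum of two labels is the sumset, i.e. the operation \<open>+\<close> on sets from
  \<open>HOL-Library.Set_Algebras\<close>. It is commutative, so the value does not depend
  on the order in which the end points of an edge are given.
\<close>

definition edge_label :: "('a \<Rightarrow> nat set) \<Rightarrow> 'a \<Rightarrow> 'a \<Rightarrow> nat set" where
  "edge_label f u v = f u + f v"

definition iasl :: "'a ugraph \<Rightarrow> nat set \<Rightarrow> ('a \<Rightarrow> nat set) \<Rightarrow> bool" where
  "iasl G X f \<longleftrightarrow>
     inj_on f (verts G) \<and> f ` verts G \<subseteq> Pow X \<and>
     (\<forall>u v. {u, v} \<in> edges G \<longrightarrow> edge_label f u v \<in> Pow X)"

definition wiasl :: "'a ugraph \<Rightarrow> nat set \<Rightarrow> ('a \<Rightarrow> nat set) \<Rightarrow> bool" where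
  "wiasl G X f \<longleftrightarrow>
     iasl G X f \<and>
     (\<forall>u v. {u, v} \<in> edges G \<longrightarrow>
        card (edge_label f u v) = max (card (f u)) (card (f v)))"

definition one_uniform :: "'a ugraph \<Rightarrow> ('a \<Rightarrow> nat set) \<Rightarrow> bool" where
  "one_uniform G f \<longleftrightarrow> (\<forall>u v. {u, v} \<in> edges G \<longrightarrow> card (edge_label f u v) = 1)"

text \<open>
  The infimum of a non-empty set of natural numbers is its minimum, and \<open>Inf {} = 0\<close>.
  As ground sets are non-empty, the value is 0 exactly if there is no labeling, and a
  positive value is attained.
\<close>

definition weak_set_labeling_number :: "'a ugraph \<Rightarrow> nat" where
  "weak_set_labeling_number G =
     Inf {card X | X. finite X \<and> X \<noteq> {} \<and> (\<exists>f. wiasl G X f \<and> \<not> one_uniform G f)}"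

definition cycle_graph :: "nat \<Rightarrow> nat ugraph" where
  "cycle_graph n = ({..<n}, {{i, Suc i mod n} | i. i < n})"

lemma simple_graph_cycle_graph:
  assumes "n \<ge> 3"
  shows "simple_graph (cycle_graph n)"
proof -
  have "i \<noteq> Suc i mod n" if "i < n" for i
    using that assms by (cases "Suc i = n") auto
  then show ?thesis
    using assms by (auto simp: simple_graph_def cycle_graph_def)
qed

lemma no_isolated_vertices_cycle_graph: "no_isolated_vertices (cycle_graph n)"
  by (auto simp: no_isolated_vertices_def cycle_graph_def)

end

theory Submission
  imports Defs
begin

text \<open>
  Sumsets of naturals satisfy \<open>card (A + B) > max (card A) (card B)\<close> unless one summand has at most
  one element, so in a weak labeling of \<open>C\<^sub>n\<close> every edge has an end point labelled by a singleton:
  there are at least \<open>n/2\<close> of them. The singleton of \<open>Max X\<close> is not a label, since both its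
  neighbours would have to be labelled \<open>{0}\<close>; hence \<open>card X \<ge> 1 + n/2\<close>. If \<open>n\<close> is even and equality
  holds, singletons alternate with larger labels and every \<open>x \<in> X - {Max X}\<close> is a singleton label.
  For the second largest element \<open>M'\<close> of \<open>X\<close>, both neighbours must then be labelled
  \<open>{0, Max X - M'}\<close>, contradicting injectivity. Conversely, with \<open>k = n div 2\<close>, the labels
  \<open>{0}, {0, k}, {1}, {0, k - 1}, {2}, \<dots>\<close> along the cycle use the ground set \<open>{0..k + 1}\<close>.
\<close>

section \<open>Cardinalities of sumsets\<close>

lemma card_less_card_sumset:
  fixes A B :: "nat set"
  assumes "finite A" "A \<noteq> {}" "finite B" "card B \<ge> 2"
  shows "card A < card (A + B)"
proof -
  have "\<not> card B \<le> Suc 0" using assms(4) by simp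
  then obtain b c where bc: "b \<in> B" "c \<in> B" "b < c"
    using card_le_Suc0_iff_eq[OF assms(3)] by (meson linorder_neqE_nat)
  \<comment> \<open>This translate already has \<open>card A\<close> elements, and
    \<open>Max A + c\<close> exceeds all of them because \<open>b < c\<close>.\<close>
  let ?I = "(\<lambda>a. a + b) ` A"
  have "Max A + c \<notin> ?I"
  proof
    assume "Max A + c \<in> ?I"
    then obtain a where "a \<in> A" "Max A + c = a + b" by auto
    with Max_ge[OF assms(1) \<open>a \<in> A\<close>] bc show False by linarith
  qed
  then have "card (insert (Max A + c) ?I) = Suc (card A)"
    using assms(1) by (simp add: card_image)
  moreover have "insert (Max A + c) ?I \<subseteq> A + B"
    using bc Max_in[OF assms(1,2)] by (intro insert_subsetI image_subsetI set_plus_intro)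
  moreover have "finite (A + B)"
    using assms by (intro finite_set_plus)
  ultimately show ?thesis
    by (metis Suc_le_eq card_mono)
qed

lemma card_sumset_eq_max_imp_singleton:
  fixes A B :: "nat set"
  assumes "finite A" "A \<noteq> {}" "finite B" "B \<noteq> {}"
    and "card (A + B) = max (card A) (card B)"
  shows "card A = 1 \<or> card B = 1"
proof (rule ccontr)
  assume "\<not> ?thesis"
  then have "card A \<ge> 2" "card B \<ge> 2"
    using assms card_gt_0_iff[of A] card_gt_0_iff[of B] by linarith+
  then have "card A < card (A + B)" "card B < card (B + A)"
    using assms card_less_card_sumset by blast+
  then show False
    using assms(5) by (simp add: add.commute)
qed

section \<open>The lower bound\<close>

lemma inj_on_Suc_mod: "inj_on (\<lambda>i. Suc i mod n) {..<n}"
  by (auto simp: inj_on_def mod_Suc split: if_splits)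

text \<open>Equal labels on both neighbours of a vertex contradict injectivity only if these
  neighbours differ; for \<open>n = 2\<close> they coincide.\<close>

lemma Suc_mod_predecessor:
  assumes "n \<ge> 3" "i < n"
  obtains p where "p < n" "Suc p mod n = i" "p \<noteq> Suc i mod n"
proof (cases i)
  case 0
  then show ?thesis using assms that[of "n - 1"] by (auto simp: mod_Suc)
next
  case (Suc j)
  then show ?thesis using assms that[of j] by (auto simp: mod_Suc)
qed

lemma card_ground_set_cycle_ge:
  fixes f :: "nat \<Rightarrow> nat set"
  assumes n: "n \<ge> 3" and fin: "finite X" and w: "wiasl (cycle_graph n) X f"
  shows "2 + n div 2 \<le> card X"
proof -
  let ?s = "\<lambda>i. Suc i mod n"
  have s_less: "?s i < n" for i using n by simp
  have inj: "inj_on f {..<n}"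
    using w by (simp add: wiasl_def iasl_def cycle_graph_def)
  have sub: "f i \<subseteq> X" if "i < n" for i
    using w that by (auto simp: wiasl_def iasl_def cycle_graph_def)
  have edge: "f i + f (?s i) \<subseteq> X"
      "card (f i + f (?s i)) = max (card (f i)) (card (f (?s i)))" if "i < n" for i
  proof -
    have "{i, ?s i} \<in> edges (cycle_graph n)"
      using that by (auto simp: cycle_graph_def)
    then show "f i + f (?s i) \<subseteq> X"
      "card (f i + f (?s i)) = max (card (f i)) (card (f (?s i)))"
      using w by (simp_all add: wiasl_def iasl_def edge_label_def)
  qed
  have fin_f: "finite (f i)" if "i < n" for i
    using sub[OF that] fin finite_subset by blast
  have f_eq: "i = j" if "f i = f j" "i < n" "j < n" for i j
    using inj_onD[OF inj that(1)] that by simp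
  \<comment> \<open>An empty label makes the edge label empty, so by the maximum rule the next
    vertex has the empty label too, against injectivity.\<close>
  have nonempty: "f i \<noteq> {}" if i: "i < n" for i
  proof
    assume e: "f i = {}"
    then have "card (f (?s i)) = 0"
      using edge(2)[OF i] by (simp add: set_plus_def)
    then have "f (?s i) = f i"
      using e fin_f s_less by simp
    then have "?s i = i" using f_eq i s_less by blast
    then show False using n i by (auto simp: mod_Suc split: if_splits)
  qed
  define S where "S = {i. i < n \<and> card (f i) = 1}"
  \<comment> \<open>Let \<open>i\<close> stand for the edge from \<open>i\<close> to
    \<open>?s i\<close>: then \<open>S \<union> T\<close> collects the edges with an end point in
    \<open>S\<close>, and \<open>S \<inter> T\<close> those with both.\<close>
  define T where "T = {i. i < n \<and> ?s i \<in> S}"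
  have finST: "finite S" "finite T" by (auto simp: S_def T_def)
  have cover: "S \<union> T = {..<n}"
  proof -
    have "i \<in> S \<union> T" if "i < n" for i
      using card_sumset_eq_max_imp_singleton[OF fin_f[OF that] nonempty[OF that]
          fin_f[OF s_less] nonempty[OF s_less] edge(2)[OF that]] that s_less
      by (simp add: S_def T_def)
    then show ?thesis by (auto simp: S_def T_def)
  qed
  have T_le: "card T \<le> card S"
  proof (rule card_inj_on_le[OF _ _ finST(1)])
    show "inj_on ?s T"
      by (rule inj_on_subset[OF inj_on_Suc_mod]) (auto simp: T_def)
    show "?s ` T \<subseteq> S" by (auto simp: T_def)
  qed
  define x where "x i = the_elem (f i)" for i
  have x: "f i = {x i}" if "i \<in> S" for i
  proof -
    have "card (f i) = 1" using that by (simp add: S_def)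
    then show ?thesis unfolding x_def by (metis card_1_singletonE the_elem_eq)
  qed
  \<comment> \<open>The edge labels at \<open>i\<close> are translates by \<open>x i\<close> of the
    neighbours' labels, so a large \<open>x i\<close> leaves the neighbours little room.\<close>
  have neighbours: "\<exists>p q. p < n \<and> q < n \<and> p \<noteq> q \<and> ?s p = i \<and> q = ?s i
      \<and> f p \<subseteq> {y. x i + y \<in> X} \<and> f q \<subseteq> {y. x i + y \<in> X}" if i: "i \<in> S" for i
  proof -
    have "i < n" using i by (simp add: S_def)
    with n obtain p where p: "p < n" "?s p = i" "p \<noteq> ?s i"
      using Suc_mod_predecessor by blast
    have "f p + {x i} \<subseteq> X" "{x i} + f (?s i) \<subseteq> X"
      using edge(1)[OF p(1)] edge(1)[OF \<open>i < n\<close>] p(2) x[OF i] by auto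
    then have "f p \<subseteq> {y. x i + y \<in> X}" "f (?s i) \<subseteq> {y. x i + y \<in> X}"
      by (auto simp: set_plus_def add.commute)
    with p show ?thesis
      by (intro exI[of _ p] exI[of _ "?s i"] conjI s_less) simp_all
  qed
  have inj_x: "inj_on x S"
  proof (rule inj_onI)
    fix i j assume ij: "i \<in> S" "j \<in> S" "x i = x j"
    then have "f i = f j" using x[OF ij(1)] x[OF ij(2)] by simp
    then show "i = j" using ij by (intro f_eq) (simp_all add: S_def)
  qed
  have "f 0 \<noteq> {}" "f 0 \<subseteq> X" using nonempty sub n by auto
  then have "X \<noteq> {}" by blast
  define M where "M = Max X"
  have M: "M \<in> X" "\<And>y. y \<in> X \<Longrightarrow> y \<le> M"
    using fin \<open>X \<noteq> {}\<close> by (auto simp: M_def)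
  have xX: "x ` S \<subseteq> X - {M}"
  proof
    fix y assume "y \<in> x ` S"
    then obtain i where i: "i \<in> S" "y = x i" by blast
    have "x i \<in> X" using x[OF i(1)] sub i by (force simp: S_def)
    moreover have "x i \<noteq> M"
    proof
      assume eq: "x i = M"
      obtain p q where pq: "p < n" "q < n" "p \<noteq> q"
        "f p \<subseteq> {y. M + y \<in> X}" "f q \<subseteq> {y. M + y \<in> X}"
        using neighbours[OF i(1)] eq by auto
      have "{y. M + y \<in> X} \<subseteq> {0}" using M(2) by force
      with pq nonempty have "f p = {0}" "f q = {0}" by blast+
      with f_eq pq show False by metis
    qed
    ultimately show "y \<in> X - {M}" using i by simp
  qed
  have card_S: "card S \<le> card (X - {M})"
    using card_inj_on_le[OF inj_x xX] fin by simp
  have card_XM: "card X = Suc (card (X - {M}))"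
    using card_Suc_Diff1[OF fin M(1)] by simp
  have n_le: "n + card (S \<inter> T) = card S + card T"
    using card_Un_Int[OF finST] cover by simp
  show ?thesis
  proof (rule ccontr)
    assume "\<not> ?thesis"
    then have bounds: "card (X - {M}) \<le> n div 2" using card_XM by linarith
    \<comment> \<open>Equality holds throughout \<open>n + card (S \<inter> T) \<le> 2 * card S
      \<le> 2 * (n div 2) \<le> n\<close>; in particular \<open>n\<close> is even.\<close>
    then have eqs: "card S = card (X - {M})" "card (S \<inter> T) = 0" "n = 2 * card S"
      using n_le T_le card_S by linarith+
    have disj: "S \<inter> T = {}" using eqs(2) finST by simp
    have xS: "x ` S = X - {M}"
      using xX eqs(1) inj_x fin by (intro card_subset_eq) (auto simp: card_image)
    have "X - {M} \<noteq> {}" using eqs n by (metis card.empty mult_0_right not_numeral_le_zero)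
    define M' where "M' = Max (X - {M})"
    have M': "M' \<in> X - {M}" "\<And>y. y \<in> X - {M} \<Longrightarrow> y \<le> M'"
      using fin \<open>X - {M} \<noteq> {}\<close> Max_in[of "X - {M}"] by (auto simp: M'_def)
    have "M' \<in> x ` S" using M'(1) unfolding xS .
    then obtain i where i: "i \<in> S" "x i = M'" by auto
    obtain p q where pq: "p < n" "q < n" "p \<noteq> q" "?s p = i" "q = ?s i"
      "f p \<subseteq> {y. M' + y \<in> X}" "f q \<subseteq> {y. M' + y \<in> X}"
      using neighbours[OF i(1)] unfolding i(2) by blast
    \<comment> \<open>Disjointness of \<open>S\<close> and \<open>T\<close> forbids singletons on
      consecutive vertices.\<close>
    have "p \<notin> S" using disj pq(1,4) i(1) by (auto simp: T_def)
    moreover have "i \<notin> T" using disj i(1) by blast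
    then have "q \<notin> S" using pq(5) i(1) by (simp add: T_def S_def)
    ultimately have not1: "card (f p) \<noteq> 1" "card (f q) \<noteq> 1"
      using pq(1,2) by (simp_all add: S_def)
    have two: "{y. M' + y \<in> X} \<subseteq> {0, M - M'}"
    proof
      fix y assume "y \<in> {y. M' + y \<in> X}"
      then have "M' + y = M \<or> M' + y \<le> M'" using M'(2)[of "M' + y"] by blast
      then show "y \<in> {0, M - M'}" by auto
    qed
    have full: "B = {0, M - M'}" if "B \<subseteq> {0, M - M'}" "B \<noteq> {}" "card B \<noteq> 1" for B
    proof -
      have "B = {} \<or> B = {0} \<or> B = {M - M'} \<or> B = {0, M - M'}" using that(1) by blast
      then show ?thesis using that(2,3) by (elim disjE) simp_all
    qed
    have "f p = f q"
      using full[OF subset_trans[OF pq(6) two] nonempty[OF pq(1)] not1(1)]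
        full[OF subset_trans[OF pq(7) two] nonempty[OF pq(2)] not1(2)] by simp
    from f_eq[OF this pq(1,2)] pq(3) show False by blast
  qed
qed

section \<open>A labeling that attains the bound\<close>

definition alternating_label :: "nat \<Rightarrow> nat \<Rightarrow> nat set" where
  "alternating_label k v = (if even v then {v div 2} else {0, k - v div 2})"

text \<open>Each edge has an even end point, whose singleton label makes the sumset a translate.
  With \<open>k = n div 2\<close>, singletons grow as pairs shrink: the edge from
  \<open>2 * j\<close> to \<open>2 * j + 1\<close> gets \<open>{j, k}\<close>, and the one from
  \<open>2 * j + 1\<close> to \<open>2 * j + 2\<close> gets \<open>{j + 1, k + 1}\<close>.\<close>

lemma alternating_label_edge:
  assumes "i < n"
  shows "alternating_label (n div 2) i + alternating_label (n div 2) (Suc i mod n)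
           \<subseteq> {..Suc (n div 2)}"
    and "card (alternating_label (n div 2) i + alternating_label (n div 2) (Suc i mod n)) =
      max (card (alternating_label (n div 2) i))
        (card (alternating_label (n div 2) (Suc i mod n)))"
proof -
  let ?f = "alternating_label (n div 2)"
  have shift: "{a} + B = (+) a ` B" "B + {a} = (+) a ` B" for a :: nat and B
    by (auto simp: set_plus_def add.commute)
  have card_pos: "card (?f v) \<ge> 1" for v
    by (auto simp: alternating_label_def card_insert_if)
  have card_shift: "card ({a} + ?f v) = max (card {a}) (card (?f v))"
    "card (?f v + {a}) = max (card (?f v)) (card {a})" for a v
    using card_pos[of v] by (auto simp: shift card_image)
  \<comment> \<open>The third case is the closing edge for even \<open>n\<close>; for odd
    \<open>n\<close> that edge starts at the even vertex \<open>n - 1\<close>.\<close>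
  consider "even i" | "odd i" "Suc i mod n = Suc i" | "odd i" "Suc i mod n = 0"
    using assms by (cases "Suc i = n") auto
  then have "?f i + ?f (Suc i mod n) \<subseteq> {..Suc (n div 2)} \<and>
    card (?f i + ?f (Suc i mod n)) = max (card (?f i)) (card (?f (Suc i mod n)))"
  proof cases
    case 1
    then have fi: "?f i = {i div 2}" by (simp add: alternating_label_def)
    have "{i div 2} + ?f (Suc i mod n) \<subseteq> {..Suc (n div 2)}"
      using 1 assms by (cases "Suc i = n") (auto simp: shift alternating_label_def)
    then show ?thesis using card_shift(1) fi by metis
  next
    case 2
    then have fs: "?f (Suc i mod n) = {Suc i div 2}" by (simp add: alternating_label_def)
    have "?f i + {Suc i div 2} \<subseteq> {..Suc (n div 2)}"
      using 2 assms by (auto simp: shift alternating_label_def)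
    then show ?thesis using card_shift(2) fs by metis
  next
    case 3
    then have fs: "?f (Suc i mod n) = {0}" by (simp add: alternating_label_def)
    have "?f i + {0} \<subseteq> {..Suc (n div 2)}"
      using 3 assms by (auto simp: shift alternating_label_def)
    then show ?thesis using card_shift(2) fs by metis
  qed
  then show "?f i + ?f (Suc i mod n) \<subseteq> {..Suc (n div 2)}"
    "card (?f i + ?f (Suc i mod n)) = max (card (?f i)) (card (?f (Suc i mod n)))"
    by blast+
qed

lemma inj_on_alternating_label: "inj_on (alternating_label (n div 2)) {..<n}"
proof (rule inj_onI)
  fix u v assume uv: "u \<in> {..<n}" "v \<in> {..<n}"
    and eq: "alternating_label (n div 2) u = alternating_label (n div 2) v"
  \<comment> \<open>Thus no label of an odd vertex collapses to \<open>{0}\<close>, the label of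
    vertex 0.\<close>
  have pos: "n div 2 - w div 2 > 0" if "odd w" "w < n" for w
    using that by (auto elim!: oddE)
  show "u = v"
    using uv eq pos[of u] pos[of v]
    by (auto simp: alternating_label_def doubleton_eq_iff split: if_splits elim!: evenE oddE)
qed

lemma wiasl_alternating_label:
  "wiasl (cycle_graph n) {..Suc (n div 2)} (alternating_label (n div 2))"
proof -
  let ?f = "alternating_label (n div 2)"
  have "?f v \<subseteq> {..Suc (n div 2)}" if "v < n" for v
    using that by (auto simp: alternating_label_def)
  moreover have "?f u + ?f v \<subseteq> {..Suc (n div 2)} \<and>
      card (?f u + ?f v) = max (card (?f u)) (card (?f v))"
    if uv: "{u, v} \<in> edges (cycle_graph n)" for u v
  proof -
    obtain i where i: "i < n" "{u, v} = {i, Suc i mod n}"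
      using uv by (auto simp: cycle_graph_def)
    then consider "u = i" "v = Suc i mod n" | "v = i" "u = Suc i mod n"
      by (auto simp: doubleton_eq_iff)
    then show ?thesis
    proof cases
      case 1
      then show ?thesis using alternating_label_edge[OF i(1)] by simp
    next
      case 2
      then show ?thesis
        using alternating_label_edge[OF i(1)] add.commute[of "?f u"] by (simp add: max.commute)
    qed
  qed
  ultimately show ?thesis
    using inj_on_alternating_label
    by (auto simp: wiasl_def iasl_def edge_label_def cycle_graph_def)
qed

lemma not_one_uniform_alternating_label:
  assumes "n \<ge> 2"
  shows "\<not> one_uniform (cycle_graph n) (alternating_label (n div 2))"
proof -
  have "{0, 1} \<in> edges (cycle_graph n)"
    using assms by (auto simp: cycle_graph_def intro!: exI[of _ 0])
  moreover have "edge_label (alternating_label (n div 2)) 0 1 = {0, n div 2}"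
    by (auto simp: edge_label_def alternating_label_def set_plus_def)
  \<comment> \<open>Here \<open>n \<ge> 2\<close> makes \<open>n div 2\<close> nonzero.\<close>
  moreover have "card {0, n div 2} = 2"
    using assms by simp
  ultimately show ?thesis
    by (metis one_uniform_def numeral_eq_one_iff num.distinct(1))
qed

theorem theorem2p3:
  fixes n :: nat
  assumes "n \<ge> 3"
  shows "weak_set_labeling_number (cycle_graph n) = 2 + n div 2"
  unfolding weak_set_labeling_number_def
proof (rule cInf_eq_minimum)
  have "finite {..Suc (n div 2)} \<and> {..Suc (n div 2)} \<noteq> {} \<and>
      (\<exists>f. wiasl (cycle_graph n) {..Suc (n div 2)} f \<and> \<not> one_uniform (cycle_graph n) f)"
    using wiasl_alternating_label not_one_uniform_alternating_label assms by fastforce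
  \<comment> \<open>The ground set includes 0, hence one element more than its maximum.\<close>
  moreover have "2 + n div 2 = card {..Suc (n div 2)}" by simp
  ultimately show "2 + n div 2 \<in> {card X | X. finite X \<and> X \<noteq> {} \<and>
      (\<exists>f. wiasl (cycle_graph n) X f \<and> \<not> one_uniform (cycle_graph n) f)}"
    by blast
qed (use card_ground_set_cycle_ge assms in blast)

end
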